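(* Let $M\in\mathrm{O}_{n_3}(\mathbb{R})$ and let $\mathcal{A}\in\mathbb{R}_M^{n\times n}$ be symmetric. Then $\mathcal{A}$ is $\star_M$-PSD if and only if $\mathrm{bdiag}(\widehat{\mathcal{A}})$ is a positive semidefinite matrix.
   Context: $\mathrm{O}_{n_3}(\mathbb{R})$ is the group of real orthogonal $n_3\times n_3$ matrices. A tube is an element $\mathbf{a}\in\mathbb{R}^{1\times1\times n_3}$; $\mathrm{vec}(\mathbf{a})\in\mathbb{R}^{n_3}$ has entries $\mathbf{a}_{1,1,k}$, and $\mathrm{tube}$ is the inverse of $\mathrm{vec}$; $\mathrm{diag}(v)$ is the diagonal matrix with diagonal $v$. The $\star_M$-product of tubes is $\mathbf{a}\star_M\mathbf{b}=\mathrm{tube}(M^{-1}\mathrm{diag}(M\mathrm{vec}(\mathbf{a}))M\mathrm{vec}(\mathbf{b}))$, and $\mathbb{R}_M$ is the resulting ring of tubes. $\mathbb{R}_M^{n_1\times n_2}$ denotes $\mathbb{R}^{n_1\times n_2\times n_3}$ viewed as $n_1\times n_2$ matrices of tubes $\mathcal{A}_{i,j,:}$, with product $(\mathcal{A}\star_M\mathcal{B})_{i,j,:}=\sum_\ell\mathcal{A}_{i,\ell,:}\star_M\mathcal{B}_{\ell,j,:}$; $\mathbb{R}_M^n=\mathbb{R}^{n\times1\times n_3}$. The inner product is $\langle\mathcal{A},\mathcal{B}\rangle=\sum_{i,j,k}\mathcal{A}_{i,j,k}\mathcal{B}_{i,j,k}$. A tensor $\mathcal{A}\in\mathbb{R}_M^{n\times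 n}$ is symmetric if every frontal slice $\mathcal{A}_{:,:,k}$ is a symmetric matrix. A symmetric $\mathcal{A}\in\mathbb{R}_M^{n\times n}$ is $\star_M$-PSD if $\langle\mathcal{X},\mathcal{A}\star_M\mathcal{X}\rangle\ge0$ for all $\mathcal{X}\in\mathbb{R}_M^n$. The transform is $\widehat{\mathcal{A}}=\mathcal{A}\times_3M$, defined by $\widehat{\mathcal{A}}_{i,j,:}=\mathrm{tube}(M\mathrm{vec}(\mathcal{A}_{i,j,:}))$. $\mathrm{bdiag}(\mathcal{B})$ is the block diagonal $nn_3\times nn_3$ matrix with diagonal blocks the frontal slices $\mathcal{B}_{:,:,1},\dots,\mathcal{B}_{:,:,n_3}$. *)

theory Defs
  imports "HOL-Analysis.Analysis"
begin

text \<open>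
  A tube, i.e. an element of \<open>\<real>\<^bsup>1\<times>1\<times>n\<^sub>3\<^esup>\<close>, is identified with its vector of entries, so that
  the maps vec and tube are the identity. An \<open>n\<^sub>1 \<times> n\<^sub>2 \<times> n\<^sub>3\<close> tensor is an \<open>n\<^sub>1 \<times> n\<^sub>2\<close> matrix of
  tubes: the entry with indices \<open>i, j, k\<close> is \<open>A $ i $ j $ k\<close>. With this nesting the library inner
  product on \<open>real^'k^'m^'n\<close> unfolds to the sum of \<open>A $ i $ j $ k * B $ i $ j $ k\<close> over all
  \<open>i, j, k\<close>.
\<close>

type_synonym 'k tube = "real^'k"

type_synonym ('n, 'm, 'k) tensor = "real^'k^'m^'n"

definition diag :: "real^'k \<Rightarrow> real^'k^'k" where
  "diag v = (\<chi> i j. if i = j then v $ i else 0)"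

definition tube_prod :: "real^'k^'k \<Rightarrow> 'k::finite tube \<Rightarrow> 'k tube \<Rightarrow> 'k tube" where
  "tube_prod M a b = (matrix_inv M ** diag (M *v a) ** M) *v b"

definition star_prod ::
  "real^'k^'k \<Rightarrow> ('n::finite, 'l::finite, 'k::finite) tensor \<Rightarrow> ('l, 'm::finite, 'k) tensor
     \<Rightarrow> ('n, 'm, 'k) tensor" where
  "star_prod M A B = (\<chi> i j. \<Sum>l\<in>UNIV. tube_prod M (A $ i $ l) (B $ l $ j))"

definition frontal_slice ::
  "('n::finite, 'm::finite, 'k::finite) tensor \<Rightarrow> 'k \<Rightarrow> real^'m^'n" where
  "frontal_slice A k = (\<chi> i j. A $ i $ j $ k)"

definition symmetric_matrix :: "real^'n^'n \<Rightarrow> bool" where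
  "symmetric_matrix S \<longleftrightarrow> transpose S = S"

definition symmetric_tensor :: "('n::finite, 'n, 'k::finite) tensor \<Rightarrow> bool" where
  "symmetric_tensor A \<longleftrightarrow> (\<forall>k. symmetric_matrix (frontal_slice A k))"

definition star_PSD :: "real^'k^'k \<Rightarrow> ('n::finite, 'n, 'k::finite) tensor \<Rightarrow> bool" where
  "star_PSD M A \<longleftrightarrow>
     symmetric_tensor A \<and> (\<forall>X :: ('n, 1, 'k) tensor. X \<bullet> star_prod M A X \<ge> 0)"

definition mode3_prod ::
  "('n::finite, 'm::finite, 'k::finite) tensor \<Rightarrow> real^'k^'k \<Rightarrow> ('n, 'm, 'k) tensor" where
  "mode3_prod A M = (\<chi> i j. M *v (A $ i $ j))"

text \<open>
  The \<open>nn\<^sub>3\<close> rows and columns of the block diagonal matrix are indexed by pairs \<open>(k, i)\<close> consisting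
  of the number \<open>k\<close> of the block and the position \<open>i\<close> within that block.
\<close>

definition bdiag :: "('n::finite, 'n, 'k::finite) tensor \<Rightarrow> real^('k \<times> 'n)^('k \<times> 'n)" where
  "bdiag B = (\<chi> p q. if fst p = fst q then frontal_slice B (fst p) $ snd p $ snd q else 0)"

definition PSD_matrix :: "real^'n^'n \<Rightarrow> bool" where
  "PSD_matrix S \<longleftrightarrow> symmetric_matrix S \<and> (\<forall>x. x \<bullet> (S *v x) \<ge> 0)"

end

theory Submission
  imports Defs
begin

text \<open>
  The substitution \<open>X \<mapsto> X \<times>\<^sub>3 M\<close> turns the quadratic form of \<open>A\<close> into that of
  \<open>bdiag (A \<times>\<^sub>3 M)\<close>, since \<open>M\<close> preserves inner products and the tube product becomes entrywise
  after the transform. The substitution is onto because \<open>M\<close> is invertible, so one form is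
  nonnegative exactly when the other is.
\<close>

lemma matrix_inv_orthogonal:
  fixes M :: "real^'k^'k"
  assumes "orthogonal_matrix M"
  shows "matrix_inv M = transpose M"
proof -
  \<comment> \<open>\<open>matrix_inv\<close> is a Hilbert choice; \<open>transpose M\<close>
    witnesses that a two-sided inverse exists.\<close>
  have "M ** matrix_inv M = mat 1"
    using assms someI[of "\<lambda>N. M ** N = mat 1 \<and> N ** M = mat 1" "transpose M"]
    by (simp add: orthogonal_matrix_def matrix_inv_def)
  then have "transpose M ** M ** matrix_inv M = transpose M"
    by (simp flip: matrix_mul_assoc)
  then show ?thesis
    using assms by (simp add: orthogonal_matrix_def)
qed

lemma diag_mult_vector: "(diag v *v w) $ i = v $ i * w $ i"
  by (simp add: diag_def matrix_vector_mult_def if_distrib if_distribR sum.delta cong: if_cong)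

text \<open>The outer factor \<open>matrix_inv M\<close> is \<open>transpose M\<close>, so it moves
  across the inner product and becomes \<open>M\<close> acting on \<open>x\<close>; the diagonal
  factor then multiplies entrywise.\<close>

lemma inner_tube_prod:
  assumes "orthogonal_matrix M"
  shows "x \<bullet> tube_prod M a b = (\<Sum>k\<in>UNIV. (M *v x) $ k * (M *v a) $ k * (M *v b) $ k)"
proof -
  have "x \<bullet> tube_prod M a b = x \<bullet> (transpose M *v (diag (M *v a) *v (M *v b)))"
    by (simp add: tube_prod_def matrix_inv_orthogonal[OF assms] matrix_vector_mul_assoc
        matrix_mul_assoc)
  also have "\<dots> = (M *v x) \<bullet> (diag (M *v a) *v (M *v b))"
    by (metis dot_lmul_matrix inner_commute transpose_matrix_vector)
  also have "\<dots> = (\<Sum>k\<in>UNIV. (M *v x) $ k * (M *v a) $ k * (M *v b) $ k)"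
    by (simp add: inner_vec_def diag_mult_vector mult.assoc)
  finally show ?thesis .
qed

text \<open>Off-diagonal blocks vanish, so row and column share the block number \<open>k\<close>.
  The sum over \<open>k\<close> is innermost to match \<open>inner_tube_prod\<close> summed over
  \<open>i\<close> and \<open>l\<close>.\<close>

lemma inner_bdiag:
  "y \<bullet> (bdiag B *v y) =
     (\<Sum>i\<in>UNIV. \<Sum>l\<in>UNIV. \<Sum>k\<in>UNIV. y $ (k, i) * B $ i $ l $ k * y $ (k, l))"
proof -
  have "(bdiag B *v y) $ (k, i) = (\<Sum>l\<in>UNIV. B $ i $ l $ k * y $ (k, l))" for k i
  proof -
    have "(bdiag B *v y) $ (k, i) =
        (\<Sum>k'\<in>UNIV. \<Sum>l\<in>UNIV. (if k = k' then B $ i $ l $ k else 0) * y $ (k', l))"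
      by (simp add: bdiag_def matrix_vector_mult_def frontal_slice_def sum.cartesian_product
          case_prod_unfold cong: if_cong)
    also have "\<dots> = (\<Sum>k'\<in>UNIV. if k = k' then \<Sum>l\<in>UNIV. B $ i $ l $ k * y $ (k', l) else 0)"
      by (intro sum.cong) auto
    finally show ?thesis by simp
  qed
  then have "y \<bullet> (bdiag B *v y) =
      (\<Sum>k\<in>UNIV. \<Sum>i\<in>UNIV. \<Sum>l\<in>UNIV. y $ (k, i) * B $ i $ l $ k * y $ (k, l))"
    by (simp add: inner_vec_def sum_distrib_left mult.assoc sum.cartesian_product'
        flip: UNIV_Times_UNIV)
  also have "\<dots> = (\<Sum>i\<in>UNIV. \<Sum>k\<in>UNIV. \<Sum>l\<in>UNIV. y $ (k, i) * B $ i $ l $ k * y $ (k, l))"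
    by (rule sum.swap)
  also have "\<dots> = (\<Sum>i\<in>UNIV. \<Sum>l\<in>UNIV. \<Sum>k\<in>UNIV. y $ (k, i) * B $ i $ l $ k * y $ (k, l))"
    by (intro sum.cong refl sum.swap)
  finally show ?thesis .
qed

lemma inner_star_prod:
  fixes X :: "('n::finite, 1, 'k::finite) tensor"
  assumes "orthogonal_matrix M"
  shows "X \<bullet> star_prod M A X =
    (\<chi> p. (M *v X $ snd p $ 1) $ fst p) \<bullet>
      (bdiag (mode3_prod A M) *v (\<chi> p. (M *v X $ snd p $ 1) $ fst p))"
proof -
  have "X \<bullet> star_prod M A X =
      (\<Sum>i\<in>UNIV. \<Sum>l\<in>UNIV. X $ i $ 1 \<bullet> tube_prod M (A $ i $ l) (X $ l $ 1))"
    \<comment> \<open>The instantiations unfold only the two outer index levels, leaving inner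
      products of tubes for \<open>inner_tube_prod\<close>.\<close>
    by (simp add: inner_vec_def[of X] inner_vec_def[of "X $ _"] star_prod_def inner_sum_right)
  then show ?thesis
    by (simp add: inner_tube_prod[OF assms] inner_bdiag mode3_prod_def)
qed

text \<open>Symmetry in every slice means that whole tubes agree under swapping \<open>i\<close> and
  \<open>j\<close>, and \<open>M\<close> acts on each tube separately.\<close>

lemma symmetric_matrix_bdiag:
  assumes "symmetric_tensor A"
  shows "symmetric_matrix (bdiag (mode3_prod A M))"
proof -
  have "A $ i $ j $ k = A $ j $ i $ k" for i j k
    using assms by (auto simp: symmetric_tensor_def symmetric_matrix_def frontal_slice_def
        transpose_def vec_eq_iff)
  then have A: "A $ i $ j = A $ j $ i" for i j
    by (simp add: vec_eq_iff)
  have "(M *v A $ i $ j) $ k = (M *v A $ j $ i) $ k" for i j k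
    by (subst A) (rule refl)
  then show ?thesis
    unfolding symmetric_matrix_def
    by (subst vec_eq_iff) (simp add: bdiag_def transpose_def vec_eq_iff frontal_slice_def
        mode3_prod_def)
qed

theorem proposition3p3:
  fixes M :: "real^'k^'k"
    and A :: "('n::finite, 'n, 'k::finite) tensor"
  assumes "orthogonal_matrix M"
    and "symmetric_tensor A"
  shows "star_PSD M A \<longleftrightarrow> PSD_matrix (bdiag (mode3_prod A M))"
proof
  assume psd: "star_PSD M A"
  have "y \<bullet> (bdiag (mode3_prod A M) *v y) \<ge> 0" for y
  proof -
    \<comment> \<open>The preimage of \<open>y\<close> under the substitution:
      \<open>transpose M\<close> undoes the transform on each tube collected from
      \<open>y\<close>.\<close>
    define X :: "('n, 1, 'k) tensor"
      where "X = (\<chi> i j. transpose M *v (\<chi> k. y $ (k, i)))"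
    have "(\<chi> p. (M *v X $ snd p $ 1) $ fst p) = y"
      using assms(1) by (simp add: X_def matrix_vector_mul_assoc orthogonal_matrix_def vec_lambda_eta
          del: transpose_matrix_vector)
    then show ?thesis
      using psd inner_star_prod[OF assms(1), of X A] by (metis star_PSD_def)
  qed
  then show "PSD_matrix (bdiag (mode3_prod A M))"
    using symmetric_matrix_bdiag[OF assms(2)] by (simp add: PSD_matrix_def)
next
  assume "PSD_matrix (bdiag (mode3_prod A M))"
  then show "star_PSD M A"
    using assms(2) by (simp add: star_PSD_def PSD_matrix_def inner_star_prod[OF assms(1)])
qed

end
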